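(* Let $n\ge 2$, let $\sigma\in\mathbb{S}_n$, and let $\vec\alpha=(\alpha_1,\dots,\alpha_{n-1})\in(0,1]^{n-1}$ and $\vec\theta=(\theta_1,\dots,\theta_{n-1})\in(0,1]^{n-1}$. Then the crossentropy between the Generalized Mallows Models $P_{\mathrm{id},\vec\alpha}$ (sampling distribution) and $P_{\sigma,\vec\theta}$ (model) is $$\operatorname{XE}(P_{\mathrm{id},\vec\alpha}\,\|\,P_{\sigma,\vec\theta})\;=\;\sum_{r=1}^{n-1}\Big[\bar{s}_r(\sigma,\alpha_{1:r})\,\ln\theta_r+\ln Z_{n-r+1}(\theta_r)\Big],$$ where $\bar{s}_r=\bar{s}_r(\sigma,\alpha_{1:r})=\mathbb{E}_{\pi\sim P_{\mathrm{id},\vec\alpha}}[s_r(\pi|\sigma)]$.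
   Context: $\mathbb{S}_n$ is the set of permutations of the items $\{1,\dots,n\}$. A permutation $\pi$ is written as an ordered list $\pi=[\pi_1,\dots,\pi_n]$, where $\pi_i$ is the item at rank $i$; $\mathrm{id}=[1,\dots,n]$. For items $e\ne e'$, $e\prec_\sigma e'$ means that $e$ is ranked before $e'$ in $\sigma$. For $\pi,\sigma\in\mathbb{S}_n$ and $1\le r\le n-1$, the code $s_r(\pi|\sigma)$ is the number of items $e'\in\{\pi_{r+1},\dots,\pi_n\}$ with $e'\prec_\sigma \pi_r$. For $m\ge1$ and $\theta\in(0,1]$, $Z_m(\theta)=\sum_{i=0}^{m-1}\theta^i$. The Generalized Mallows Model with central permutation $\sigma\in\mathbb{S}_n$ and dispersion parameters $\vec\theta\in(0,1]^{n-1}$ is the probability distribution on $\mathbb{S}_n$ given by $$P_{\sigma,\vec\theta}(\pi)=\prod_{r=1}^{n-1}\frac{\theta_r^{\,s_r(\pi|\sigma)}}{Z_{n-r+1}(\theta_r)}.$$ For distributions $P,P'$ on a finite set, the crossentropy is $\operatorname{XE}(P\|P')=\mathbb{E}_P[-\ln P']$ (natural logarithm). The notation $\alpha_{1:r}$ stands for $\alpha_1,\dots,\alpha_r$; the arguments of $\bar s_r$ list the quantities on which it depends.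
   Formalization: The sign of the first term is corrected: the formal statement has −s̄_r ln θ_r instead of +s̄_r ln θ_r; the printed sign already fails for n=2, σ=id, α_1=θ_1=1/2 (both agree if all θ_r=1). *)

theory Defs
  imports "HOL-Probability.Probability" "HOL-Combinatorics.Multiset_Permutations"
begin

text \<open>
  A permutation of the items \<open>1, \<dots>, n\<close> is the list of the items in rank order, that is, a member
  of \<^term>\<open>permutations_of_set {1..n::nat}\<close>. Ranks are counted from 1 and lists from 0: the item
  at rank \<open>r\<close> of \<open>\<pi>\<close> is \<open>\<pi> ! (r - 1)\<close>, and the items at ranks \<open>r + 1, \<dots>, n\<close> are the
  elements of \<open>drop r \<pi>\<close>. Parameter vectors are functions on \<open>nat\<close> read at the ranks
  \<open>1, \<dots>, n - 1\<close> only.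
\<close>

definition id_perm :: "nat \<Rightarrow> nat list" where
  "id_perm n = [1..<Suc n]"

definition precedes :: "nat list \<Rightarrow> nat \<Rightarrow> nat \<Rightarrow> bool" where
  "precedes \<sigma> e e' \<longleftrightarrow> (\<exists>i j. i < j \<and> j < length \<sigma> \<and> \<sigma> ! i = e \<and> \<sigma> ! j = e')"

definition code :: "nat \<Rightarrow> nat list \<Rightarrow> nat list \<Rightarrow> nat" where
  "code r \<pi> \<sigma> = card {e' \<in> set (drop r \<pi>). precedes \<sigma> e' (\<pi> ! (r - 1))}"

definition Z :: "nat \<Rightarrow> real \<Rightarrow> real" where
  "Z m \<theta> = (\<Sum>i<m. \<theta> ^ i)"

definition gmm_mass :: "nat \<Rightarrow> nat list \<Rightarrow> (nat \<Rightarrow> real) \<Rightarrow> nat list \<Rightarrow> real" where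
  "gmm_mass n \<sigma> \<theta> \<pi> = (\<Prod>r=1..n-1. \<theta> r ^ code r \<pi> \<sigma> / Z (n - r + 1) (\<theta> r))"

definition gmm :: "nat \<Rightarrow> nat list \<Rightarrow> (nat \<Rightarrow> real) \<Rightarrow> nat list pmf" where
  "gmm n \<sigma> \<theta> =
     embed_pmf (\<lambda>\<pi>. if \<pi> \<in> permutations_of_set {1..n} then gmm_mass n \<sigma> \<theta> \<pi> else 0)"

text \<open>
  The crossentropy is meant for \<open>P\<close> of finite support contained in the support of \<open>Q\<close>; otherwise
  the conventions \<open>ln 0 = 0\<close> and "integral of a non-integrable function is 0" would intervene.
  Lemma \<open>set_pmf_gmm\<close> below shows that the condition holds between any two of these models on the
  same items.

  The negated logarithm turns a factor \<open>\<theta> ^ s\<close> of \<open>Q\<close> into the nonnegative term \<open>- s * ln \<theta>\<close> for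
  \<open>\<theta> \<le> 1\<close>. This is the sign of the mean codes in the crossentropy of two models; a version with
  \<open>+ s * ln \<theta>\<close> fails already for two items and both parameters \<open>1/2\<close>.
\<close>

definition crossentropy :: "'a pmf \<Rightarrow> 'a pmf \<Rightarrow> real" where
  "crossentropy P Q = measure_pmf.expectation P (\<lambda>x. - ln (pmf Q x))"

definition mean_code :: "nat \<Rightarrow> nat list \<Rightarrow> (nat \<Rightarrow> real) \<Rightarrow> nat \<Rightarrow> real" where
  "mean_code n \<sigma> \<alpha> r = measure_pmf.expectation (gmm n (id_perm n) \<alpha>) (\<lambda>\<pi>. real (code r \<pi> \<sigma>))"

definition dispersion :: "nat \<Rightarrow> (nat \<Rightarrow> real) \<Rightarrow> bool" where
  "dispersion n \<theta> \<longleftrightarrow> (\<forall>r\<in>{1..n-1}. 0 < \<theta> r \<and> \<theta> r \<le> 1)"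

text \<open>
  The masses are positive and sum to 1, so \<^const>\<open>embed_pmf\<close> yields the intended distribution.
\<close>

lemma id_perm_in_permutations: "id_perm n \<in> permutations_of_set {1..n}"
  by (auto simp: id_perm_def permutations_of_set_def)

lemma Z_pos: "0 < t \<Longrightarrow> 0 < m \<Longrightarrow> 0 < Z m t"
  unfolding Z_def by (rule sum_pos) auto

lemma Z_1 [simp]: "Z (Suc 0) t = 1"
  by (simp add: Z_def)

lemma precedes_irrefl: "distinct \<sigma> \<Longrightarrow> \<not> precedes \<sigma> e e"
  by (auto simp: precedes_def nth_eq_iff_index_eq)

lemma precedes_trans:
  assumes "distinct \<sigma>" "precedes \<sigma> a b" "precedes \<sigma> b c"
  shows "precedes \<sigma> a c"
proof -
  obtain i j where 1: "i < j" "j < length \<sigma>" "\<sigma> ! i = a" "\<sigma> ! j = b"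
    using assms(2) by (auto simp: precedes_def)
  obtain k l where 2: "k < l" "l < length \<sigma>" "\<sigma> ! k = b" "\<sigma> ! l = c"
    using assms(3) by (auto simp: precedes_def)
  have "j = k"
    using 1 2 assms(1) nth_eq_iff_index_eq[of \<sigma> j k] by simp
  then show ?thesis
    unfolding precedes_def using 1 2 by (intro exI[of _ i] exI[of _ l]) simp
qed

lemma precedes_total:
  assumes "a \<in> set \<sigma>" "b \<in> set \<sigma>" "a \<noteq> b"
  shows "precedes \<sigma> a b \<or> precedes \<sigma> b a"
proof -
  obtain i j where "i < length \<sigma>" "\<sigma> ! i = a" "j < length \<sigma>" "\<sigma> ! j = b"
    using assms(1,2) by (auto simp: in_set_conv_nth)
  then show ?thesis
    using assms(3) by (cases i j rule: linorder_cases) (auto simp: precedes_def)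
qed

lemma sum_power_rank:
  fixes t :: real
  assumes "distinct \<sigma>" "finite A" "A \<subseteq> set \<sigma>"
  shows "(\<Sum>x\<in>A. t ^ card {e \<in> A - {x}. precedes \<sigma> e x}) = Z (card A) t"
proof -
  define rk where "rk = (\<lambda>x. card {e \<in> A - {x}. precedes \<sigma> e x})"
  have less: "rk x < rk y" if "x \<in> A" "y \<in> A" "precedes \<sigma> x y" for x y
    unfolding rk_def
  proof (rule psubset_card_mono)
    show "finite {e \<in> A - {y}. precedes \<sigma> e y}"
      using assms(2) by simp
    show "{e \<in> A - {x}. precedes \<sigma> e x} \<subset> {e \<in> A - {y}. precedes \<sigma> e y}"
      using that precedes_trans[OF assms(1)] precedes_irrefl[OF assms(1)] by blast
  qed
  have inj: "inj_on rk A"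
  proof (rule inj_onI, rule ccontr)
    fix x y assume "x \<in> A" "y \<in> A" "rk x = rk y" "x \<noteq> y"
    then show False
      using less[of x y] less[of y x] precedes_total[of x \<sigma> y] assms(3) by fastforce
  qed
  have "rk x < card A" if "x \<in> A" for x
    unfolding rk_def by (rule psubset_card_mono) (use assms(2) that in auto)
  then have "rk ` A = {..<card A}"
    by (intro card_subset_eq) (auto simp: card_image[OF inj])
  then have "(\<Sum>x\<in>A. t ^ rk x) = (\<Sum>i<card A. t ^ i)"
    using sum.reindex[OF inj, of "\<lambda>i. t ^ i"] by simp
  then show ?thesis
    by (simp add: rk_def Z_def)
qed

lemma code_Cons_Suc: "code (Suc (Suc r)) (x # \<pi>) \<sigma> = code (Suc r) \<pi> \<sigma>"
  by (simp add: code_def)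

lemma sum_permutations_Suc:
  fixes f :: "nat list \<Rightarrow> real"
  assumes "card A = Suc n"
  shows "(\<Sum>\<pi>\<in>permutations_of_set A. f \<pi>) =
    (\<Sum>x\<in>A. \<Sum>\<pi>\<in>permutations_of_set (A - {x}). f (x # \<pi>))"
proof -
  have fin: "finite A" and ne: "A \<noteq> {}"
    using assms card.infinite by force+
  have "(\<Sum>\<pi>\<in>permutations_of_set A. f \<pi>) =
    (\<Sum>x\<in>A. \<Sum>\<pi>\<in>(#) x ` permutations_of_set (A - {x}). f \<pi>)"
    unfolding permutations_of_set_nonempty[OF ne]
    by (rule sum.UNION_disjoint) (use fin in auto)
  also have "\<dots> = (\<Sum>x\<in>A. \<Sum>\<pi>\<in>permutations_of_set (A - {x}). f (x # \<pi>))"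
    by (rule sum.cong) (auto simp: sum.reindex inj_on_def)
  finally show ?thesis .
qed

lemma sum_prod_code:
  assumes "distinct \<sigma>"
  shows "card A = n \<Longrightarrow> finite A \<Longrightarrow> A \<subseteq> set \<sigma> \<Longrightarrow>
    (\<Sum>\<pi>\<in>permutations_of_set A. \<Prod>r<n. \<theta> (Suc r) ^ code (Suc r) \<pi> \<sigma>) =
    (\<Prod>r<n. Z (n - r) (\<theta> (Suc r)))"
proof (induction n arbitrary: A \<theta>)
  case 0
  then show ?case by simp
next
  case (Suc n)
  have IH: "(\<Sum>\<pi>\<in>permutations_of_set (A - {x}).
      \<Prod>r<n. \<theta> (Suc (Suc r)) ^ code (Suc r) \<pi> \<sigma>) = (\<Prod>r<n. Z (n - r) (\<theta> (Suc (Suc r))))"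
    if "x \<in> A" for x
    using Suc.IH[of "A - {x}" "\<lambda>r. \<theta> (Suc r)"] Suc.prems that by auto
  have head: "code (Suc 0) (x # \<pi>) \<sigma> = card {e \<in> A - {x}. precedes \<sigma> e x}"
    if "\<pi> \<in> permutations_of_set (A - {x})" for x \<pi>
    using permutations_of_setD(1)[OF that] by (simp add: code_def)
  have "(\<Sum>\<pi>\<in>permutations_of_set A. \<Prod>r<Suc n. \<theta> (Suc r) ^ code (Suc r) \<pi> \<sigma>) =
    (\<Sum>x\<in>A. \<Sum>\<pi>\<in>permutations_of_set (A - {x}). \<theta> (Suc 0) ^ card {e \<in> A - {x}. precedes \<sigma> e x} *
       (\<Prod>r<n. \<theta> (Suc (Suc r)) ^ code (Suc r) \<pi> \<sigma>))"
    unfolding sum_permutations_Suc[OF Suc.prems(1)]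
    by (intro sum.cong refl) (simp add: prod.lessThan_Suc_shift code_Cons_Suc head del: prod.lessThan_Suc)
  also have "\<dots> = (\<Sum>x\<in>A. \<theta> (Suc 0) ^ card {e \<in> A - {x}. precedes \<sigma> e x} *
       (\<Prod>r<n. Z (n - r) (\<theta> (Suc (Suc r)))))"
    by (intro sum.cong refl) (simp add: IH flip: sum_distrib_left)
  also have "\<dots> = Z (Suc n) (\<theta> (Suc 0)) * (\<Prod>r<n. Z (n - r) (\<theta> (Suc (Suc r))))"
    using sum_power_rank[OF assms Suc.prems(2,3), of "\<theta> (Suc 0)"] Suc.prems(1)
    by (simp flip: sum_distrib_right)
  finally show ?case
    by (simp add: prod.lessThan_Suc_shift del: prod.lessThan_Suc)
qed

lemma gmm_mass_pos:
  assumes "dispersion n \<theta>"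
  shows "0 < gmm_mass n \<sigma> \<theta> \<pi>"
  unfolding gmm_mass_def
  by (intro prod_pos) (use assms in \<open>auto simp: dispersion_def intro!: divide_pos_pos Z_pos\<close>)

lemma sum_gmm_mass:
  assumes "\<sigma> \<in> permutations_of_set {1..n}" "dispersion n \<theta>"
  shows "(\<Sum>\<pi>\<in>permutations_of_set {1..n}. gmm_mass n \<sigma> \<theta> \<pi>) = 1"
proof (cases n)
  case 0
  then show ?thesis by (simp add: gmm_mass_def)
next
  case (Suc m)
  note \<sigma> = permutations_of_setD[OF assms(1)]
  have shift: "(\<Prod>r=1..n-1. f r) = (\<Prod>r<m. f (Suc r))" for f :: "nat \<Rightarrow> real"
    using Suc prod.atLeast1_atMost_eq[of f m] by simp
  have last: "code (Suc m) \<pi> \<sigma> = 0" if "\<pi> \<in> permutations_of_set {1..n}" for \<pi>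
    using Suc length_finite_permutations_of_set[OF that] by (simp add: code_def)
  have pos: "0 < (\<Prod>r<m. Z (n - r) (\<theta> (Suc r)))"
    by (intro prod_pos) (use assms(2) Suc in \<open>auto simp: dispersion_def intro!: Z_pos\<close>)
  have "(\<Sum>\<pi>\<in>permutations_of_set {1..n}. gmm_mass n \<sigma> \<theta> \<pi>) =
    (\<Sum>\<pi>\<in>permutations_of_set {1..n}. \<Prod>r<n. \<theta> (Suc r) ^ code (Suc r) \<pi> \<sigma>) /
      (\<Prod>r<m. Z (n - r) (\<theta> (Suc r)))"
    unfolding sum_divide_distrib gmm_mass_def shift
    by (intro sum.cong refl) (use Suc last in \<open>simp add: prod_dividef Suc_diff_le\<close>)
  also have "(\<Sum>\<pi>\<in>permutations_of_set {1..n}. \<Prod>r<n. \<theta> (Suc r) ^ code (Suc r) \<pi> \<sigma>) =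
    (\<Prod>r<n. Z (n - r) (\<theta> (Suc r)))"
    by (rule sum_prod_code[OF \<sigma>(2)]) (use \<sigma>(1) in auto)
  also have "\<dots> = (\<Prod>r<m. Z (n - r) (\<theta> (Suc r)))"
    using Suc by simp
  also have "\<dots> / \<dots> = 1"
    using less_imp_neq[OF pos] by (intro divide_self) (rule not_sym)
  finally show ?thesis .
qed

lemma pmf_gmm:
  assumes "\<sigma> \<in> permutations_of_set {1..n}" "dispersion n \<theta>"
  shows "pmf (gmm n \<sigma> \<theta>) \<pi> =
    (if \<pi> \<in> permutations_of_set {1..n} then gmm_mass n \<sigma> \<theta> \<pi> else 0)"
  unfolding gmm_def
proof (rule pmf_embed_pmf)
  let ?S = "permutations_of_set {1..n}"
  let ?f = "\<lambda>\<pi>. if \<pi> \<in> ?S then gmm_mass n \<sigma> \<theta> \<pi> else 0"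
  show nonneg: "0 \<le> ?f \<pi>" for \<pi>
    using gmm_mass_pos[OF assms(2)] by (simp add: less_imp_le)
  have "(\<integral>\<^sup>+ \<pi>. ennreal (?f \<pi>) \<partial>count_space UNIV) = (\<Sum>\<pi>\<in>?S. ennreal (?f \<pi>))"
    by (rule nn_integral_count_space') auto
  also have "\<dots> = ennreal (\<Sum>\<pi>\<in>?S. ?f \<pi>)"
    by (rule sum_ennreal) (rule nonneg)
  also have "\<dots> = 1"
    using sum_gmm_mass[OF assms] by simp
  finally show "(\<integral>\<^sup>+ \<pi>. ennreal (?f \<pi>) \<partial>count_space UNIV) = 1" .
qed

lemma set_pmf_gmm:
  assumes "\<sigma> \<in> permutations_of_set {1..n}" "dispersion n \<theta>"
  shows "set_pmf (gmm n \<sigma> \<theta>) = permutations_of_set {1..n}"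
proof (rule set_eqI)
  fix \<pi>
  show "\<pi> \<in> set_pmf (gmm n \<sigma> \<theta>) \<longleftrightarrow> \<pi> \<in> permutations_of_set {1..n}"
    unfolding set_pmf_iff pmf_gmm[OF assms]
    using gmm_mass_pos[OF assms(2), of \<sigma> \<pi>] by simp
qed

end

theory Submission
  imports Defs
begin

text \<open>
  The logarithm of the model mass is a sum over the ranks, so linearity of expectation gives the
  formula. For the dependence on \<open>\<alpha>\<^sub>1, \<dots>, \<alpha>\<^sub>r\<close> only: the model draws the items
  rank by rank, the parameter at a rank governing the choice of the item at that rank, so the law of
  the first \<open>r\<close> items does not involve the later parameters; and the code at rank \<open>r\<close> is a
  function of the first \<open>r\<close> items.
\<close>

text \<open>The denominators multiply to exactly the sum of the numerators given by
  \<open>sum_prod_code\<close>. Nonvanishing of \<open>Z\<close> is assumed instead of a range for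
  the parameters because the product also reads \<open>\<theta> n\<close>, on which
  \<open>dispersion n\<close> says nothing.\<close>

lemma sum_prod_code_normalized:
  assumes "distinct \<sigma>" "card A = n" "finite A" "A \<subseteq> set \<sigma>"
    and "\<And>i. i < n \<Longrightarrow> Z (n - i) (\<theta> (Suc i)) \<noteq> 0"
  shows "(\<Sum>\<pi>\<in>permutations_of_set A.
    \<Prod>i<n. \<theta> (Suc i) ^ code (Suc i) \<pi> \<sigma> / Z (n - i) (\<theta> (Suc i))) = 1"
proof -
  have "(\<Prod>i<n. Z (n - i) (\<theta> (Suc i))) \<noteq> 0"
    using assms(5) by simp
  then show ?thesis
    using sum_prod_code[OF assms(1-4), of \<theta>] by (simp add: prod_dividef flip: sum_divide_distrib)
qed

text \<open>Induction on the length of the prefix, splitting off the first item. Once the prefix is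
  used up, the factors of the later ranks sum to 1, so their parameters drop out. The item set
  \<open>A\<close> shrinks along the way, while \<open>\<sigma>\<close> keeps its role as a fixed
  ordering of a larger set.\<close>

lemma sum_prefix_cong:
  fixes f :: "nat list \<Rightarrow> real"
  assumes "distinct \<sigma>"
  shows "card A = n \<Longrightarrow> finite A \<Longrightarrow> A \<subseteq> set \<sigma> \<Longrightarrow>
    (\<And>i. i < n \<Longrightarrow> Z (n - i) (\<theta> (Suc i)) \<noteq> 0) \<Longrightarrow>
    (\<And>i. i < n \<Longrightarrow> Z (n - i) (\<eta> (Suc i)) \<noteq> 0) \<Longrightarrow>
    (\<And>i. i < r \<Longrightarrow> \<theta> (Suc i) = \<eta> (Suc i)) \<Longrightarrow>
    (\<Sum>\<pi>\<in>permutations_of_set A.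
      (\<Prod>i<n. \<theta> (Suc i) ^ code (Suc i) \<pi> \<sigma> / Z (n - i) (\<theta> (Suc i))) * f (take r \<pi>)) =
    (\<Sum>\<pi>\<in>permutations_of_set A.
      (\<Prod>i<n. \<eta> (Suc i) ^ code (Suc i) \<pi> \<sigma> / Z (n - i) (\<eta> (Suc i))) * f (take r \<pi>))"
proof (induction r arbitrary: n A \<theta> \<eta> f)
  case 0
  \<comment> \<open>The empty prefix makes \<open>f\<close> constant, and each side is total mass 1
    times \<open>f []\<close>.\<close>
  then show ?case
    using sum_prod_code_normalized[OF assms 0(1-4)] sum_prod_code_normalized[OF assms 0(1-3,5)]
    by (simp flip: sum_distrib_right)
next
  case (Suc r)
  show ?case
  proof (cases n)
    case 0
    then show ?thesis by simp
  next
    case (Suc m)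
    have cA: "card A = Suc m"
      using Suc Suc.prems(1) by simp
    have head: "code (Suc 0) (x # \<pi>) \<sigma> = card {e \<in> A - {x}. precedes \<sigma> e x}"
      if "\<pi> \<in> permutations_of_set (A - {x})" for x \<pi>
      using permutations_of_setD(1)[OF that] by (simp add: code_def)
    \<comment> \<open>Whatever the order of the tail, its items are \<open>A - {x}\<close>; the
      first code therefore depends on \<open>x\<close> alone and its factor leaves the inner sum.
      The free \<open>\<zeta>\<close> serves both parameter vectors.\<close>
    have split: "(\<Sum>\<pi>\<in>permutations_of_set A.
        (\<Prod>i<n. \<zeta> (Suc i) ^ code (Suc i) \<pi> \<sigma> / Z (n - i) (\<zeta> (Suc i))) * f (take (Suc r) \<pi>)) =
      (\<Sum>x\<in>A. \<zeta> (Suc 0) ^ card {e \<in> A - {x}. precedes \<sigma> e x} / Z n (\<zeta> (Suc 0)) *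
        (\<Sum>\<pi>\<in>permutations_of_set (A - {x}).
          (\<Prod>i<m. \<zeta> (Suc (Suc i)) ^ code (Suc i) \<pi> \<sigma> / Z (m - i) (\<zeta> (Suc (Suc i)))) *
          f (x # take r \<pi>)))" for \<zeta>
      unfolding sum_permutations_Suc[OF cA] sum_distrib_left
      by (intro sum.cong refl)
        (simp add: Suc prod.lessThan_Suc_shift code_Cons_Suc head mult.assoc del: prod.lessThan_Suc)
    have IH: "(\<Sum>\<pi>\<in>permutations_of_set (A - {x}).
        (\<Prod>i<m. \<theta> (Suc (Suc i)) ^ code (Suc i) \<pi> \<sigma> / Z (m - i) (\<theta> (Suc (Suc i)))) *
        f (x # take r \<pi>)) =
      (\<Sum>\<pi>\<in>permutations_of_set (A - {x}).
        (\<Prod>i<m. \<eta> (Suc (Suc i)) ^ code (Suc i) \<pi> \<sigma> / Z (m - i) (\<eta> (Suc (Suc i)))) *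
        f (x # take r \<pi>))" if "x \<in> A" for x
    \<comment> \<open>The tail starts at rank 2 of the original list, hence the shifted parameters;
      the item already drawn is absorbed into the test function.\<close>
    proof (rule Suc.IH[where \<theta> = "\<lambda>i. \<theta> (Suc i)" and \<eta> = "\<lambda>i. \<eta> (Suc i)"
          and f = "\<lambda>xs. f (x # xs)"])
      show "Z (m - i) (\<theta> (Suc (Suc i))) \<noteq> 0" if "i < m" for i
        using Suc.prems(4)[of "Suc i"] that Suc by simp
      show "Z (m - i) (\<eta> (Suc (Suc i))) \<noteq> 0" if "i < m" for i
        using Suc.prems(5)[of "Suc i"] that Suc by simp
    qed (use that cA Suc.prems in auto)
    show ?thesis
      unfolding split using Suc.prems(6)[of 0] by (simp add: IH)
  qed
qed

text \<open>The items after rank \<open>r\<close> are those missing from the prefix, so their order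
  is irrelevant to the code. For \<open>r = 0\<close> the prefix is empty and would not contain the
  item \<open>\<pi> ! (r - 1)\<close>.\<close>

lemma code_take:
  assumes "\<pi> \<in> permutations_of_set A" "0 < r"
  shows "code r \<pi> \<sigma> = card {e \<in> A - set (take r \<pi>). precedes \<sigma> e (take r \<pi> ! (r - 1))}"
proof -
  have "set (drop r \<pi>) = set \<pi> - set (take r \<pi>)"
    using permutations_of_setD(2)[OF assms(1)]
      set_take_disj_set_drop_if_distinct[of \<pi> r r] set_append[of "take r \<pi>" "drop r \<pi>"]
    by auto
  then show ?thesis
    using assms(2) permutations_of_setD(1)[OF assms(1)] by (simp add: code_def)
qed

lemma expectation_gmm:
  fixes f :: "nat list \<Rightarrow> real"
  assumes "\<sigma> \<in> permutations_of_set {1..n}" "dispersion n \<theta>"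
  shows "measure_pmf.expectation (gmm n \<sigma> \<theta>) f =
    (\<Sum>\<pi>\<in>permutations_of_set {1..n}. gmm_mass n \<sigma> \<theta> \<pi> * f \<pi>)"
proof -
  have "measure_pmf.expectation (gmm n \<sigma> \<theta>) f =
    (\<Sum>\<pi>\<in>permutations_of_set {1..n}. f \<pi> * pmf (gmm n \<sigma> \<theta>) \<pi>)"
    by (rule integral_measure_pmf_real) (use set_pmf_gmm[OF assms] in auto)
  then show ?thesis
    by (simp add: pmf_gmm[OF assms] mult.commute)
qed

text \<open>The additional factor at rank \<open>n\<close> is 1: no item follows the last one, and
  \<open>Z 1\<close> is constantly 1. Running over all \<open>n\<close> ranks gives the product the
  form on which the recursion over lists works.\<close>

lemma gmm_mass_eq_prod:
  assumes "\<pi> \<in> permutations_of_set {1..n}"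
  shows "gmm_mass n \<sigma> \<theta> \<pi> =
    (\<Prod>i<n. \<theta> (Suc i) ^ code (Suc i) \<pi> \<sigma> / Z (n - i) (\<theta> (Suc i)))"
proof (cases n)
  case 0
  then show ?thesis by (simp add: gmm_mass_def)
next
  case (Suc m)
  have "code (Suc m) \<pi> \<sigma> = 0"
    using Suc length_finite_permutations_of_set[OF assms] by (simp add: code_def)
  then show ?thesis
    using Suc by (auto simp: gmm_mass_def prod.atLeast1_atMost_eq Suc_diff_Suc Suc_diff_le intro!: prod.cong)
qed

text \<open>Positivity of the parameter settles every rank but the last, where the parameter is
  arbitrary and the value \<open>Z 1 = 1\<close> is used instead.\<close>

lemma Z_dispersion_nonzero:
  assumes "dispersion n \<theta>" "i < n"
  shows "Z (n - i) (\<theta> (Suc i)) \<noteq> 0"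
proof (cases "Suc i = n")
  case True
  then show ?thesis by (auto simp: Suc_diff_le)
next
  case False
  then have "0 < \<theta> (Suc i)"
    using assms by (auto simp: dispersion_def)
  then show ?thesis
    using Z_pos[of "\<theta> (Suc i)" "n - i"] assms(2) by simp
qed

lemma mean_code_cong:
  assumes "dispersion n \<alpha>" "dispersion n \<beta>" "0 < r" "\<And>i. i \<in> {1..r} \<Longrightarrow> \<beta> i = \<alpha> i"
  shows "mean_code n \<sigma> \<beta> r = mean_code n \<sigma> \<alpha> r"
proof -
  let ?S = "permutations_of_set {1..n}"
  \<comment> \<open>This is the code at rank \<open>r\<close> read off the prefix. The permutation
    \<open>\<sigma>\<close> enters only here; the weights are those of the model centred at
    \<open>id_perm n\<close>, so the prefix lemma is applied with that centre.\<close>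
  define f where
    "f xs = real (card {e \<in> {1..n} - set xs. precedes \<sigma> e (xs ! (r - 1))})" for xs
  have mean: "mean_code n \<sigma> \<gamma> r = (\<Sum>\<pi>\<in>?S. (\<Prod>i<n. \<gamma> (Suc i) ^ code (Suc i) \<pi> (id_perm n) /
      Z (n - i) (\<gamma> (Suc i))) * f (take r \<pi>))" if "dispersion n \<gamma>" for \<gamma>
    unfolding mean_code_def expectation_gmm[OF id_perm_in_permutations that] f_def
    by (intro sum.cong refl) (simp add: gmm_mass_eq_prod code_take[OF _ assms(3)])
  show ?thesis
    unfolding mean[OF assms(1)] mean[OF assms(2)]
    by (rule sum_prefix_cong)
      (use assms id_perm_in_permutations[of n] in
        \<open>auto simp: Z_dispersion_nonzero dest: permutations_of_setD\<close>)
qed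

lemma ln_gmm_mass:
  assumes "dispersion n \<theta>"
  shows "ln (gmm_mass n \<sigma> \<theta> \<pi>) =
    (\<Sum>r=1..n-1. real (code r \<pi> \<sigma>) * ln (\<theta> r) - ln (Z (n - r + 1) (\<theta> r)))"
proof -
  have pos: "0 < \<theta> r" "0 < Z (n - r + 1) (\<theta> r)" if "r \<in> {1..n-1}" for r
    using assms that by (auto simp: dispersion_def intro!: Z_pos)
  have "ln (gmm_mass n \<sigma> \<theta> \<pi>) =
    (\<Sum>r=1..n-1. ln (\<theta> r ^ code r \<pi> \<sigma> / Z (n - r + 1) (\<theta> r)))"
    unfolding gmm_mass_def by (rule ln_prod) (use pos in \<open>force+\<close>)
  also have "\<dots> = (\<Sum>r=1..n-1. real (code r \<pi> \<sigma>) * ln (\<theta> r) - ln (Z (n - r + 1) (\<theta> r)))"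
  proof (rule sum.cong[OF refl])
    fix r assume "r \<in> {1..n-1}"
    from pos[OF this] show "ln (\<theta> r ^ code r \<pi> \<sigma> / Z (n - r + 1) (\<theta> r)) =
        real (code r \<pi> \<sigma>) * ln (\<theta> r) - ln (Z (n - r + 1) (\<theta> r))"
      by (simp add: ln_div ln_realpow)
  qed
  finally show ?thesis .
qed

lemma crossentropy_gmm:
  assumes "\<sigma> \<in> permutations_of_set {1..n}" "dispersion n \<alpha>" "dispersion n \<theta>"
  shows "crossentropy (gmm n (id_perm n) \<alpha>) (gmm n \<sigma> \<theta>) =
    (\<Sum>r=1..n-1. - mean_code n \<sigma> \<alpha> r * ln (\<theta> r) + ln (Z (n - r + 1) (\<theta> r)))"
proof -
  let ?S = "permutations_of_set {1..n}"
  let ?p = "gmm_mass n (id_perm n) \<alpha>"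
  note E = expectation_gmm[OF id_perm_in_permutations assms(2)]
  have "crossentropy (gmm n (id_perm n) \<alpha>) (gmm n \<sigma> \<theta>) =
    (\<Sum>\<pi>\<in>?S. \<Sum>r=1..n-1. ?p \<pi> * (ln (Z (n - r + 1) (\<theta> r)) - real (code r \<pi> \<sigma>) * ln (\<theta> r)))"
    unfolding crossentropy_def E
    by (intro sum.cong refl)
      (simp add: pmf_gmm[OF assms(1,3)] ln_gmm_mass[OF assms(3)]
        flip: sum_negf sum_distrib_left)
  also have "\<dots> =
    (\<Sum>r=1..n-1. \<Sum>\<pi>\<in>?S. ?p \<pi> * (ln (Z (n - r + 1) (\<theta> r)) - real (code r \<pi> \<sigma>) * ln (\<theta> r)))"
    by (rule sum.swap)
  also have "\<dots> = (\<Sum>r=1..n-1. - mean_code n \<sigma> \<alpha> r * ln (\<theta> r) + ln (Z (n - r + 1) (\<theta> r)))"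
  proof (rule sum.cong[OF refl])
    fix r
    \<comment> \<open>The normalizer does not depend on \<open>\<pi>\<close> and is weighted by the
      total mass 1; the other sum is the mean code.\<close>
    have "(\<Sum>\<pi>\<in>?S. ?p \<pi> * (ln (Z (n - r + 1) (\<theta> r)) - real (code r \<pi> \<sigma>) * ln (\<theta> r))) =
      (\<Sum>\<pi>\<in>?S. ?p \<pi>) * ln (Z (n - r + 1) (\<theta> r)) -
      (\<Sum>\<pi>\<in>?S. ?p \<pi> * real (code r \<pi> \<sigma>)) * ln (\<theta> r)"
      by (simp add: right_diff_distrib sum_subtractf sum_distrib_right mult.assoc)
    then show "(\<Sum>\<pi>\<in>?S. ?p \<pi> * (ln (Z (n - r + 1) (\<theta> r)) - real (code r \<pi> \<sigma>) * ln (\<theta> r))) =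
      - mean_code n \<sigma> \<alpha> r * ln (\<theta> r) + ln (Z (n - r + 1) (\<theta> r))"
      unfolding sum_gmm_mass[OF id_perm_in_permutations assms(2)] by (simp add: mean_code_def E)
  qed
  finally show ?thesis .
qed

theorem proposition1:
  fixes n :: nat and \<sigma> :: "nat list" and \<alpha> \<theta> :: "nat \<Rightarrow> real"
  assumes "n \<ge> 2"
    and "\<sigma> \<in> permutations_of_set {1..n}"
    and "dispersion n \<alpha>"
    and "dispersion n \<theta>"
  shows "crossentropy (gmm n (id_perm n) \<alpha>) (gmm n \<sigma> \<theta>) =
           (\<Sum>r=1..n-1. - mean_code n \<sigma> \<alpha> r * ln (\<theta> r) + ln (Z (n - r + 1) (\<theta> r)))
       \<and> (\<forall>r\<in>{1..n-1}. \<forall>\<beta>. dispersion n \<beta> \<and> (\<forall>i\<in>{1..r}. \<beta> i = \<alpha> i) \<longrightarrow>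
            mean_code n \<sigma> \<beta> r = mean_code n \<sigma> \<alpha> r)"
proof (intro conjI ballI allI impI)
  show "crossentropy (gmm n (id_perm n) \<alpha>) (gmm n \<sigma> \<theta>) =
      (\<Sum>r=1..n-1. - mean_code n \<sigma> \<alpha> r * ln (\<theta> r) + ln (Z (n - r + 1) (\<theta> r)))"
    by (rule crossentropy_gmm[OF assms(2-4)])
next
  fix r \<beta>
  assume "r \<in> {1..n-1}" "dispersion n \<beta> \<and> (\<forall>i\<in>{1..r}. \<beta> i = \<alpha> i)"
  then show "mean_code n \<sigma> \<beta> r = mean_code n \<sigma> \<alpha> r"
    by (intro mean_code_cong[OF assms(3)]) auto
qed

end
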